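(* Proof System S3VML–I is sound and strongly complete, under Semantics I, with respect to the class of all three-valued Kripke frames. That is, for any set $\Gamma$ of formulae and any formula $A$ of the three-valued modal language, $$\Gamma\vdash_{\mathrm{I}} A\iff\Gamma\vDash_{\mathrm{I}} A,$$ where $\vDash_{\mathrm{I}}$ is consequence over all three-valued pointed Kripke models.
   Context: Language. Fix a non-empty countable set $\mathbf{P}$ of propositional letters. Formulae are generated by $A::=p\mid\neg A\mid A\land A\mid A\lor A\mid\Box A$ with $p\in\mathbf{P}$. All of $\neg,\land,\lor,\Box$ are primitive symbols. Models. A three-valued Kripke model is a triple $\mathfrak{M}=(S,R,V)$ where $S$ is a non-empty set of possible worlds, $R\subseteq S\times S$ is a binary relation (with no restriction), and $V:S\times\mathbf{P}\to\{T,U,F\}$. A pointed model $\mathfrak{M},s$ is a model together with a world $s\in S$. Semantics I. Given $\mathfrak{M}$, the value $\mathrm{Val}(s,A)\in\{T,U,F\}$ is defined recursively as follows. - $\mathrm{Val}(s,p)=V(s,p)$. - $\mathrm{Val}(s,\neg A)$ is $F,U,T$ when $\mathrm{Val}(s,A)$ is $T,U,F$ respectively. - (Weak Kleene) $\mathrm{Val}(s,A\land B)=\mathrm{Val}(s,A\lor B)=U$ if $\mathrm{Val}(s,A)=U$ or $\mathrm{Val}(s,B)=U$. If both values are in $\{T,F\}$, then $\mathrm{Val}(s,A\land B)$ and $\mathrm{Val}(s,A\lor B)$ are given by classical conjunction and disjunction. - $\mathrm{Val}(s,\Box A)=T$ if $\mathrm{Val}(t,A)=T$ for all $t$ with $sRt$;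 $=U$ if $\mathrm{Val}(t,A)=U$ for some $t$ with $sRt$; $=F$ otherwise. Write $\mathfrak{M},s\vDash_{\mathrm{I}} A$ iff $\mathrm{Val}(s,A)=T$. For a set $\Gamma$ of formulae, $\Gamma\vDash_{\mathrm{I}} A$ means: for every three-valued pointed Kripke model $\mathfrak{M},s$, if $\mathfrak{M},s\vDash_{\mathrm{I}} B$ for all $B\in\Gamma$, then $\mathfrak{M},s\vDash_{\mathrm{I}} A$. Proof System S3VML–I. $\Gamma\vdash_{\mathrm{I}} A$ (for $\Gamma$ a possibly infinite set of formulae, $A$ a formula) means that $A$ is derivable by a (finite) natural deduction from assumptions in $\Gamma$ using the rules below. That is, $\vdash_{\mathrm{I}}$ is the least relation such that $\Gamma\vdash_{\mathrm{I}} A$ whenever $A\in\Gamma$, which is closed under weakening of the premise set and composition of derivations (if $\Delta\vdash_{\mathrm{I}} B$ for every $B\in\Gamma$ and $\Gamma\vdash_{\mathrm{I}} A$, then $\Delta\vdash_{\mathrm{I}} A$), and which is closed under the following rules, for all formulae $A,B,C$. Here "$X_1,\dots,X_n\,/\,Y$" means: from derivations of $X_1,\dots,X_n$ from $\Gamma$, obtain a derivation of $Y$ from $\Gamma$. - (EFQ) $A,\ \neg A\,/\,B$. - ($\neg\neg I$) $A\,/\,\neg\neg A$; ($\neg\neg E$) $\neg\neg A\,/\,A$. - ($\lor I_1$) $\neg A\land B\,/\,A\lor B$; ($\lor I_2$) $A\land\neg B\,/\,A\lor B$; ($\lor I_3$) $A\land B\,/\,A\lor B$. - ($\lor E$) if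 $\Gamma\vdash_{\mathrm{I}} A\lor B$, $\Gamma\cup\{A\land B\}\vdash_{\mathrm{I}} C$, $\Gamma\cup\{A\land\neg B\}\vdash_{\mathrm{I}} C$ and $\Gamma\cup\{\neg A\land B\}\vdash_{\mathrm{I}} C$, then $\Gamma\vdash_{\mathrm{I}} C$. - ($\land I$) $A,\ B\,/\,A\land B$; ($\land E_1$) $A\land B\,/\,A$; ($\land E_2$) $A\land B\,/\,B$. - ($\Box I$) from $\Gamma\vdash_{\mathrm{I}} A$, deduce $\{\Box B\mid B\in\Gamma\}\vdash_{\mathrm{I}}\Box A$. - ($\neg\lor I$) $\neg A\land\neg B\,/\,\neg(A\lor B)$; ($\neg\lor E$) $\neg(A\lor B)\,/\,\neg A\land\neg B$. - ($\neg\land I$) $\neg A\lor\neg B\,/\,\neg(A\land B)$; ($\neg\land E$) $\neg(A\land B)\,/\,\neg A\lor\neg B$. - ($\neg\Box I$) $\Box(A\lor\neg A)\,/\,\Box A\lor\neg\Box A$; ($\neg\Box E$) $\Box A\lor\neg\Box A\,/\,\Box(A\lor\neg A)$. *)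

theory Defs
  imports Main "HOL-Library.Countable"
begin

datatype tv = T | U | F

datatype 'p fm =
    Atom 'p
  | Neg "'p fm"  (\<open>\<^bold>\<not> _\<close> [70] 70)
  | Con "'p fm" "'p fm"  (infixr \<open>\<^bold>\<and>\<close> 65)
  | Dis "'p fm" "'p fm"  (infixr \<open>\<^bold>\<or>\<close> 60)
  | Box "'p fm"  (\<open>\<^bold>\<box> _\<close> [70] 70)

text \<open>The valuation is total on the type of worlds; only its values on \<open>worlds\<close> matter.\<close>

record ('w, 'p) model =
  worlds :: "'w set"
  rel :: "('w \<times> 'w) set"
  valuation :: "'w \<Rightarrow> 'p \<Rightarrow> tv"

definition kripke_model :: "('w, 'p) model \<Rightarrow> bool" where
  "kripke_model M \<longleftrightarrow> worlds M \<noteq> {} \<and> rel M \<subseteq> worlds M \<times> worlds M"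

fun tv_neg :: "tv \<Rightarrow> tv" where
  "tv_neg T = F"
| "tv_neg U = U"
| "tv_neg F = T"

definition tv_con :: "tv \<Rightarrow> tv \<Rightarrow> tv" where
  "tv_con x y = (if x = U \<or> y = U then U else if x = T \<and> y = T then T else F)"

definition tv_dis :: "tv \<Rightarrow> tv \<Rightarrow> tv" where
  "tv_dis x y = (if x = U \<or> y = U then U else if x = T \<or> y = T then T else F)"

primrec Val :: "('w, 'p) model \<Rightarrow> 'w \<Rightarrow> 'p fm \<Rightarrow> tv" where
  "Val M s (Atom p) = valuation M s p"
| "Val M s (\<^bold>\<not> A) = tv_neg (Val M s A)"
| "Val M s (A \<^bold>\<and> B) = tv_con (Val M s A) (Val M s B)"
| "Val M s (A \<^bold>\<or> B) = tv_dis (Val M s A) (Val M s B)"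
| "Val M s (\<^bold>\<box> A) =
    (if \<forall>t. (s, t) \<in> rel M \<longrightarrow> Val M t A = T then T
     else if \<exists>t. (s, t) \<in> rel M \<and> Val M t A = U then U
     else F)"

definition satisfies :: "('w, 'p) model \<Rightarrow> 'w \<Rightarrow> 'p fm \<Rightarrow> bool"
    (\<open>_, _ \<Turnstile> _\<close> [51, 51, 51] 50) where
  "M, s \<Turnstile> A \<longleftrightarrow> Val M s A = T"

text \<open>
  HOL cannot quantify over types inside a formula, so consequence is indexed by the type from
  which the worlds of the models are drawn. Consequence over all models entails consequence at
  every such type, so soundness has to hold at an arbitrary type, while completeness may be
  stated at one particular type; sets of formulae suffice, being the worlds of the canonical model.
\<close>

definition consequence :: "'p fm set \<Rightarrow> 'w itself \<Rightarrow> 'p fm \<Rightarrow> bool"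
    (\<open>_ \<Turnstile>\<^bsub>_\<^esub> _\<close> [51, 0, 51] 50) where
  "\<Gamma> \<Turnstile>\<^bsub>W\<^esub> A \<longleftrightarrow>
    (\<forall>(M :: ('w, 'p) model) s. kripke_model M \<longrightarrow> s \<in> worlds M \<longrightarrow>
      (\<forall>B\<in>\<Gamma>. M, s \<Turnstile> B) \<longrightarrow> M, s \<Turnstile> A)"

inductive derives :: "'p fm set \<Rightarrow> 'p fm \<Rightarrow> bool"  (infix \<open>\<turnstile>\<close> 50) where
  Assm: "A \<in> \<Gamma> \<Longrightarrow> \<Gamma> \<turnstile> A"
| Weaken: "\<Gamma> \<turnstile> A \<Longrightarrow> \<Gamma> \<subseteq> \<Delta> \<Longrightarrow> \<Delta> \<turnstile> A"
| Cut: "(\<And>B. B \<in> \<Gamma> \<Longrightarrow> \<Delta> \<turnstile> B) \<Longrightarrow> \<Gamma> \<turnstile> A \<Longrightarrow> \<Delta> \<turnstile> A"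
| EFQ: "\<Gamma> \<turnstile> A \<Longrightarrow> \<Gamma> \<turnstile> \<^bold>\<not> A \<Longrightarrow> \<Gamma> \<turnstile> B"
| NegNegI: "\<Gamma> \<turnstile> A \<Longrightarrow> \<Gamma> \<turnstile> \<^bold>\<not> (\<^bold>\<not> A)"
| NegNegE: "\<Gamma> \<turnstile> \<^bold>\<not> (\<^bold>\<not> A) \<Longrightarrow> \<Gamma> \<turnstile> A"
| DisI1: "\<Gamma> \<turnstile> \<^bold>\<not> A \<^bold>\<and> B \<Longrightarrow> \<Gamma> \<turnstile> A \<^bold>\<or> B"
| DisI2: "\<Gamma> \<turnstile> A \<^bold>\<and> \<^bold>\<not> B \<Longrightarrow> \<Gamma> \<turnstile> A \<^bold>\<or> B"
| DisI3: "\<Gamma> \<turnstile> A \<^bold>\<and> B \<Longrightarrow> \<Gamma> \<turnstile> A \<^bold>\<or> B"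
| DisE: "\<Gamma> \<turnstile> A \<^bold>\<or> B \<Longrightarrow> \<Gamma> \<union> {A \<^bold>\<and> B} \<turnstile> C \<Longrightarrow> \<Gamma> \<union> {A \<^bold>\<and> \<^bold>\<not> B} \<turnstile> C \<Longrightarrow>
    \<Gamma> \<union> {\<^bold>\<not> A \<^bold>\<and> B} \<turnstile> C \<Longrightarrow> \<Gamma> \<turnstile> C"
| ConI: "\<Gamma> \<turnstile> A \<Longrightarrow> \<Gamma> \<turnstile> B \<Longrightarrow> \<Gamma> \<turnstile> A \<^bold>\<and> B"
| ConE1: "\<Gamma> \<turnstile> A \<^bold>\<and> B \<Longrightarrow> \<Gamma> \<turnstile> A"
| ConE2: "\<Gamma> \<turnstile> A \<^bold>\<and> B \<Longrightarrow> \<Gamma> \<turnstile> B"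
| BoxI: "\<Gamma> \<turnstile> A \<Longrightarrow> {\<^bold>\<box> B | B. B \<in> \<Gamma>} \<turnstile> \<^bold>\<box> A"
| NegDisI: "\<Gamma> \<turnstile> \<^bold>\<not> A \<^bold>\<and> \<^bold>\<not> B \<Longrightarrow> \<Gamma> \<turnstile> \<^bold>\<not> (A \<^bold>\<or> B)"
| NegDisE: "\<Gamma> \<turnstile> \<^bold>\<not> (A \<^bold>\<or> B) \<Longrightarrow> \<Gamma> \<turnstile> \<^bold>\<not> A \<^bold>\<and> \<^bold>\<not> B"
| NegConI: "\<Gamma> \<turnstile> \<^bold>\<not> A \<^bold>\<or> \<^bold>\<not> B \<Longrightarrow> \<Gamma> \<turnstile> \<^bold>\<not> (A \<^bold>\<and> B)"
| NegConE: "\<Gamma> \<turnstile> \<^bold>\<not> (A \<^bold>\<and> B) \<Longrightarrow> \<Gamma> \<turnstile> \<^bold>\<not> A \<^bold>\<or> \<^bold>\<not> B"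
| NegBoxI: "\<Gamma> \<turnstile> \<^bold>\<box> (A \<^bold>\<or> \<^bold>\<not> A) \<Longrightarrow> \<Gamma> \<turnstile> \<^bold>\<box> A \<^bold>\<or> \<^bold>\<not> \<^bold>\<box> A"
| NegBoxE: "\<Gamma> \<turnstile> \<^bold>\<box> A \<^bold>\<or> \<^bold>\<not> \<^bold>\<box> A \<Longrightarrow> \<Gamma> \<turnstile> \<^bold>\<box> (A \<^bold>\<or> \<^bold>\<not> A)"

end

theory Submission imports Defs begin

text \<open>
  Soundness is a rule-by-rule check. Completeness is a canonical model argument whose worlds are
  the saturated sets: proper subsets of the language that are closed under derivability and contain,
  with every disjunction, one of the three conjunctions between which the rule for eliminating a
  disjunction distinguishes. These three cases are exactly the ways in which a weak Kleene
  disjunction can be true, so membership in a saturated set obeys the truth tables. A letter gets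
  the value \<^const>\<open>T\<close> at a world that contains it, \<^const>\<open>F\<close> at a world that contains its negation, and
  \<^const>\<open>U\<close> otherwise; accessibility is the usual one. If \<open>\<Gamma>\<close> does not derive \<open>A\<close>, a maximal
  extension of \<open>\<Gamma>\<close> that does not derive \<open>A\<close> is saturated (lemma \<open>lindenbaum\<close>), and
  the truth lemma makes it a world that verifies \<open>\<Gamma>\<close> but not \<open>A\<close>.

  The third truth value is what makes the truth lemma delicate: one has to characterise not only the
  formulae that are true at a world, but also those that are false, since falsity is not the absence of
  truth. Hence the induction treats \<open>A\<close> and \<open>\<^bold>\<not> A\<close> simultaneously. For falsity of \<open>\<^bold>\<box> A\<close>
  the point is that \<open>A \<^bold>\<or> \<^bold>\<not> A\<close> is true precisely where \<open>A\<close> is defined. The formula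
  \<open>\<^bold>\<box> (A \<^bold>\<or> \<^bold>\<not> A)\<close> therefore says that no accessible world leaves \<open>A\<close> undefined, which is when
  \<open>\<^bold>\<box> A\<close> is itself defined, and the two rules relating it to \<open>\<^bold>\<box> A \<^bold>\<or> \<^bold>\<not> \<^bold>\<box> A\<close> express this inside the calculus.
\<close>

section \<open>Soundness\<close>

lemma tv_neg_eq_iff [simp]:
  "tv_neg x = T \<longleftrightarrow> x = F" "tv_neg x = F \<longleftrightarrow> x = T"
  by (cases x; simp)+

lemma tv_con_eq_iff [simp]:
  "tv_con x y = T \<longleftrightarrow> x = T \<and> y = T"
  "tv_con x y = F \<longleftrightarrow> x = F \<and> y = F \<or> x = F \<and> y = T \<or> x = T \<and> y = F"
  by (cases x; cases y; simp add: tv_con_def)+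

lemma tv_dis_eq_iff [simp]:
  "tv_dis x y = T \<longleftrightarrow> x = T \<and> y = T \<or> x = T \<and> y = F \<or> x = F \<and> y = T"
  "tv_dis x y = F \<longleftrightarrow> x = F \<and> y = F"
  by (cases x; cases y; simp add: tv_dis_def)+

lemma Val_Box_eq_T_iff:
  "Val M s (\<^bold>\<box> A) = T \<longleftrightarrow> (\<forall>t. (s, t) \<in> rel M \<longrightarrow> Val M t A = T)"
  by simp

lemma Val_Box_eq_F_iff:
  "Val M s (\<^bold>\<box> A) = F \<longleftrightarrow>
    (\<forall>t. (s, t) \<in> rel M \<longrightarrow> Val M t A \<noteq> U) \<and> (\<exists>t. (s, t) \<in> rel M \<and> Val M t A \<noteq> T)"
  by auto

text \<open>Either side holds iff no successor of \<open>s\<close> gives \<open>A\<close> the value \<^const>\<open>U\<close>.\<close>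
lemma Val_Box_excluded_middle:
  "Val M s (\<^bold>\<box> (A \<^bold>\<or> \<^bold>\<not> A)) = T \<longleftrightarrow> Val M s (\<^bold>\<box> A \<^bold>\<or> \<^bold>\<not> \<^bold>\<box> A) = T"
proof -
  have defined: "x = T \<or> x = F \<longleftrightarrow> x \<noteq> U" for x
    by (cases x) auto
  have "Val M s (\<^bold>\<box> (A \<^bold>\<or> \<^bold>\<not> A)) = T \<longleftrightarrow> (\<forall>t. (s, t) \<in> rel M \<longrightarrow> Val M t A \<noteq> U)"
    using defined by auto
  also have "\<dots> \<longleftrightarrow> Val M s (\<^bold>\<box> A) \<noteq> U"
    by auto
  also have "\<dots> \<longleftrightarrow> Val M s (\<^bold>\<box> A \<^bold>\<or> \<^bold>\<not> \<^bold>\<box> A) = T"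
    using defined[of "Val M s (\<^bold>\<box> A)"] by (auto simp del: Val.simps(5))
  finally show ?thesis .
qed

text \<open>
  The world must vary in the induction: the rule introducing a box is applied at a world by
  appealing to the hypothesis at its successors.
\<close>
lemma soundness:
  assumes "\<Gamma> \<turnstile> A" and M: "kripke_model M" and "s \<in> worlds M"
    and "\<And>B. B \<in> \<Gamma> \<Longrightarrow> Val M s B = T"
  shows "Val M s A = T"
  using assms(1,3,4)
proof (induction arbitrary: s rule: derives.induct)
  case (Cut \<Gamma> \<Delta> A)
  then show ?case by blast
next
  case (DisE \<Gamma> A B C)
  from DisE.IH(1)[OF DisE.prems]
  consider "Val M s (A \<^bold>\<and> B) = T" | "Val M s (A \<^bold>\<and> \<^bold>\<not> B) = T" | "Val M s (\<^bold>\<not> A \<^bold>\<and> B) = T"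
    by auto
  then show ?case
  proof cases
    case 1
    show ?thesis
      by (rule DisE.IH(2)) (use 1 DisE.prems in blast)+
  next
    case 2
    show ?thesis
      by (rule DisE.IH(3)) (use 2 DisE.prems in blast)+
  next
    case 3
    show ?thesis
      by (rule DisE.IH(4)) (use 3 DisE.prems in blast)+
  qed
next
  case (BoxI \<Gamma> A)
  have "Val M t A = T" if st: "(s, t) \<in> rel M" for t
  proof (rule BoxI.IH)
    show "t \<in> worlds M"
      using st M by (auto simp: kripke_model_def)
    fix B assume "B \<in> \<Gamma>"
    then have "Val M s (\<^bold>\<box> B) = T"
      using BoxI.prems(2) by blast
    then show "Val M t B = T"
      using st unfolding Val_Box_eq_T_iff by blast
  qed
  then show ?case
    by simp
next
  case (NegBoxI \<Gamma> A)
  from NegBoxI.IH[OF NegBoxI.prems] show ?case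
    unfolding Val_Box_excluded_middle .
next
  case (NegBoxE \<Gamma> A)
  from NegBoxE.IH[OF NegBoxE.prems] show ?case
    unfolding Val_Box_excluded_middle .
next
  case (EFQ \<Gamma> A B)
  from EFQ.IH[OF EFQ.prems] show ?case by simp
qed auto

lemma derives_imp_consequence: "\<Gamma> \<turnstile> A \<Longrightarrow> \<Gamma> \<Turnstile>\<^bsub>W\<^esub> A"
  unfolding consequence_def satisfies_def by (metis soundness)

section \<open>Saturated extensions\<close>

text \<open>
  Composition of derivations may discharge infinitely many premises at once, but the derivation that
  consumes them uses only finitely many, so a finite union of finite supports suffices there too.
\<close>
lemma derives_finite_support:
  assumes "\<Gamma> \<turnstile> A"
  shows "\<exists>\<Gamma>'. finite \<Gamma>' \<and> \<Gamma>' \<subseteq> \<Gamma> \<and> \<Gamma>' \<turnstile> A"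
  using assms
proof (induction rule: derives.induct)
  case (Assm A \<Gamma>)
  then show ?case
    by (intro exI[of _ "{A}"]) (auto intro: derives.Assm)
next
  case (Cut \<Gamma> \<Delta> A)
  then obtain \<Gamma>' where \<Gamma>': "finite \<Gamma>'" "\<Gamma>' \<subseteq> \<Gamma>" "\<Gamma>' \<turnstile> A"
    by blast
  have "\<forall>B\<in>\<Gamma>'. \<exists>\<Delta>'. finite \<Delta>' \<and> \<Delta>' \<subseteq> \<Delta> \<and> \<Delta>' \<turnstile> B"
    using Cut.IH(1) \<Gamma>'(2) by blast
  then obtain f where f: "\<And>B. B \<in> \<Gamma>' \<Longrightarrow> finite (f B) \<and> f B \<subseteq> \<Delta> \<and> f B \<turnstile> B"
    by metis
  have "(\<Union>B\<in>\<Gamma>'. f B) \<turnstile> B" if "B \<in> \<Gamma>'" for B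
    using f[OF that] that by (blast intro: derives.Weaken)
  then have "(\<Union>B\<in>\<Gamma>'. f B) \<turnstile> A"
    using \<Gamma>'(3) by (rule derives.Cut)
  moreover have "finite (\<Union>B\<in>\<Gamma>'. f B)" "(\<Union>B\<in>\<Gamma>'. f B) \<subseteq> \<Delta>"
    using f \<Gamma>'(1) by auto
  ultimately show ?case
    by blast
next
  case (DisE \<Gamma> A B C)
  have split: "\<exists>\<Delta>. finite \<Delta> \<and> \<Delta> \<subseteq> \<Gamma> \<and> \<Delta> \<union> {D} \<turnstile> C"
    if supported: "\<exists>\<Delta>. finite \<Delta> \<and> \<Delta> \<subseteq> \<Gamma> \<union> {D} \<and> \<Delta> \<turnstile> C" for D
  proof -
    obtain \<Delta> where "finite \<Delta>" "\<Delta> \<subseteq> \<Gamma> \<union> {D}" "\<Delta> \<turnstile> C"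
      using supported by blast
    moreover from this(3) have "\<Delta> - {D} \<union> {D} \<turnstile> C"
      by (rule derives.Weaken) blast
    ultimately show ?thesis
      by (intro exI[of _ "\<Delta> - {D}"]) auto
  qed
  obtain \<Delta>0 where 0: "finite \<Delta>0" "\<Delta>0 \<subseteq> \<Gamma>" "\<Delta>0 \<turnstile> A \<^bold>\<or> B"
    using DisE.IH(1) by blast
  obtain \<Delta>1 where 1: "finite \<Delta>1" "\<Delta>1 \<subseteq> \<Gamma>" "\<Delta>1 \<union> {A \<^bold>\<and> B} \<turnstile> C"
    using split[OF DisE.IH(2)] by blast
  obtain \<Delta>2 where 2: "finite \<Delta>2" "\<Delta>2 \<subseteq> \<Gamma>" "\<Delta>2 \<union> {A \<^bold>\<and> \<^bold>\<not> B} \<turnstile> C"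
    using split[OF DisE.IH(3)] by blast
  obtain \<Delta>3 where 3: "finite \<Delta>3" "\<Delta>3 \<subseteq> \<Gamma>" "\<Delta>3 \<union> {\<^bold>\<not> A \<^bold>\<and> B} \<turnstile> C"
    using split[OF DisE.IH(4)] by blast
  let ?\<Delta> = "\<Delta>0 \<union> \<Delta>1 \<union> \<Delta>2 \<union> \<Delta>3"
  have "?\<Delta> \<turnstile> C"
  proof (rule derives.DisE)
    show "?\<Delta> \<turnstile> A \<^bold>\<or> B" using 0(3) by (rule derives.Weaken) blast
    show "?\<Delta> \<union> {A \<^bold>\<and> B} \<turnstile> C" using 1(3) by (rule derives.Weaken) blast
    show "?\<Delta> \<union> {A \<^bold>\<and> \<^bold>\<not> B} \<turnstile> C" using 2(3) by (rule derives.Weaken) blast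
    show "?\<Delta> \<union> {\<^bold>\<not> A \<^bold>\<and> B} \<turnstile> C" using 3(3) by (rule derives.Weaken) blast
  qed
  then show ?case
    using 0 1 2 3 by (intro exI[of _ ?\<Delta>]) auto
next
  case (BoxI \<Gamma> A)
  then obtain \<Gamma>' where "finite \<Gamma>'" "\<Gamma>' \<subseteq> \<Gamma>" "\<Gamma>' \<turnstile> A"
    by blast
  then show ?case
    by (intro exI[of _ "{\<^bold>\<box> B |B. B \<in> \<Gamma>'}"]) (auto intro: derives.BoxI)
next
  case (EFQ \<Gamma> A B)
  then obtain \<Delta> \<Delta>' where "finite \<Delta>" "\<Delta> \<subseteq> \<Gamma>" "\<Delta> \<turnstile> A" "finite \<Delta>'" "\<Delta>' \<subseteq> \<Gamma>" "\<Delta>' \<turnstile> \<^bold>\<not> A"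
    by blast
  then show ?case
    by (intro exI[of _ "\<Delta> \<union> \<Delta>'"])
      (auto intro: derives.EFQ[where A=A] derives.Weaken)
next
  case (ConI \<Gamma> A B)
  then obtain \<Delta> \<Delta>' where "finite \<Delta>" "\<Delta> \<subseteq> \<Gamma>" "\<Delta> \<turnstile> A" "finite \<Delta>'" "\<Delta>' \<subseteq> \<Gamma>" "\<Delta>' \<turnstile> B"
    by blast
  then show ?case
    by (intro exI[of _ "\<Delta> \<union> \<Delta>'"]) (auto intro: derives.ConI derives.Weaken)
next
  case (Weaken \<Gamma> A \<Delta>)
  then show ?case by blast
qed (meson derives.intros)+

text \<open>
  Properness takes the place of consistency: by ex falso, a closed set that contains a formula and its
  negation is the whole language.
\<close>
definition saturated :: "'p fm set \<Rightarrow> bool" where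
  "saturated \<Delta> \<longleftrightarrow> \<Delta> \<noteq> UNIV \<and> (\<forall>A. \<Delta> \<turnstile> A \<longrightarrow> A \<in> \<Delta>) \<and>
    (\<forall>A B. A \<^bold>\<or> B \<in> \<Delta> \<longrightarrow> A \<^bold>\<and> B \<in> \<Delta> \<or> A \<^bold>\<and> \<^bold>\<not> B \<in> \<Delta> \<or> \<^bold>\<not> A \<^bold>\<and> B \<in> \<Delta>)"

text \<open>
  Take an extension maximal among those that do not derive \<open>A\<close>, which Zorn's lemma provides because
  derivations have finite support. Adding a formula that is missing from a maximal set makes \<open>A\<close>
  derivable. If such a set contained a disjunction but none of its three cases, the elimination rule
  would therefore derive \<open>A\<close>.
\<close>
lemma lindenbaum:
  assumes "\<not> \<Gamma> \<turnstile> A"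
  shows "\<exists>\<Delta>. saturated \<Delta> \<and> \<Gamma> \<subseteq> \<Delta> \<and> A \<notin> \<Delta>"
proof -
  define \<A> where "\<A> = {\<Delta>. \<Gamma> \<subseteq> \<Delta> \<and> \<not> \<Delta> \<turnstile> A}"
  have "\<exists>\<Delta>\<in>\<A>. \<forall>X\<in>\<A>. \<Delta> \<subseteq> X \<longrightarrow> X = \<Delta>"
  proof (rule subset_Zorn_nonempty)
    show "\<A> \<noteq> {}"
      using assms by (auto simp: \<A>_def)
    fix \<C> assume ne: "\<C> \<noteq> {}" and chain: "subset.chain \<A> \<C>"
    have "\<not> \<Union>\<C> \<turnstile> A"
    proof
      assume "\<Union>\<C> \<turnstile> A"
      then obtain \<Gamma>' where "finite \<Gamma>'" "\<Gamma>' \<subseteq> \<Union>\<C>" "\<Gamma>' \<turnstile> A"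
        using derives_finite_support by blast
      then obtain \<Delta> where "\<Delta> \<in> \<C>" "\<Gamma>' \<subseteq> \<Delta>"
        using finite_subset_Union_chain[OF _ _ ne chain] by metis
      then show False
        using \<open>\<Gamma>' \<turnstile> A\<close> chain by (auto simp: \<A>_def subset.chain_def intro: derives.Weaken)
    qed
    then show "\<Union>\<C> \<in> \<A>"
      using ne chain unfolding \<A>_def subset.chain_def by blast
  qed
  then obtain \<Delta> where "\<Delta> \<in> \<A>" and maximal: "\<forall>X\<in>\<A>. \<Delta> \<subseteq> X \<longrightarrow> X = \<Delta>" ..
  then have "\<Gamma> \<subseteq> \<Delta>" and not_A: "\<not> \<Delta> \<turnstile> A"
    by (auto simp: \<A>_def)
  have extend: "\<Delta> \<union> {B} \<turnstile> A" if "B \<notin> \<Delta>" for B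
    using bspec[OF maximal, of "\<Delta> \<union> {B}"] \<open>\<Gamma> \<subseteq> \<Delta>\<close> that by (auto simp: \<A>_def)
  have "A \<notin> \<Delta>"
    using not_A derives.Assm by blast
  have "B \<in> \<Delta>" if "\<Delta> \<turnstile> B" for B
  proof (rule ccontr)
    assume "B \<notin> \<Delta>"
    have "\<Delta> \<turnstile> C" if "C \<in> \<Delta> \<union> {B}" for C
      using that \<open>\<Delta> \<turnstile> B\<close> by (auto intro: derives.Assm)
    then have "\<Delta> \<turnstile> A"
      using extend[OF \<open>B \<notin> \<Delta>\<close>] by (rule derives.Cut)
    then show False
      using not_A by contradiction
  qed
  moreover have "B \<^bold>\<and> C \<in> \<Delta> \<or> B \<^bold>\<and> \<^bold>\<not> C \<in> \<Delta> \<or> \<^bold>\<not> B \<^bold>\<and> C \<in> \<Delta>" if "B \<^bold>\<or> C \<in> \<Delta>" for B C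
    using derives.DisE[OF derives.Assm[OF that]] extend not_A by blast
  ultimately have "saturated \<Delta>"
    using \<open>A \<notin> \<Delta>\<close> by (auto simp: saturated_def)
  then show ?thesis
    using \<open>\<Gamma> \<subseteq> \<Delta>\<close> \<open>A \<notin> \<Delta>\<close> by blast
qed

section \<open>Membership in saturated sets\<close>

lemma saturated_closed: "saturated \<Delta> \<Longrightarrow> \<Delta> \<turnstile> A \<Longrightarrow> A \<in> \<Delta>"
  by (simp add: saturated_def)

lemma saturated_consistent:
  assumes "saturated \<Delta>" "A \<in> \<Delta>"
  shows "\<^bold>\<not> A \<notin> \<Delta>"
proof
  assume "\<^bold>\<not> A \<in> \<Delta>"
  with assms have "B \<in> \<Delta>" for B
    by (blast intro: saturated_closed derives.EFQ derives.Assm)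
  then show False
    using assms(1) by (auto simp: saturated_def)
qed

lemma saturated_Neg_Neg: "saturated \<Delta> \<Longrightarrow> \<^bold>\<not> \<^bold>\<not> A \<in> \<Delta> \<longleftrightarrow> A \<in> \<Delta>"
  by (blast intro: saturated_closed derives.NegNegI derives.NegNegE derives.Assm)

lemma saturated_Con: "saturated \<Delta> \<Longrightarrow> A \<^bold>\<and> B \<in> \<Delta> \<longleftrightarrow> A \<in> \<Delta> \<and> B \<in> \<Delta>"
  by (blast intro: saturated_closed derives.ConI derives.ConE1 derives.ConE2 derives.Assm)

lemma saturated_Dis:
  assumes "saturated \<Delta>"
  shows "A \<^bold>\<or> B \<in> \<Delta> \<longleftrightarrow>
    A \<in> \<Delta> \<and> B \<in> \<Delta> \<or> A \<in> \<Delta> \<and> \<^bold>\<not> B \<in> \<Delta> \<or> \<^bold>\<not> A \<in> \<Delta> \<and> B \<in> \<Delta>"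
proof -
  have "A \<^bold>\<or> B \<in> \<Delta> \<longleftrightarrow> A \<^bold>\<and> B \<in> \<Delta> \<or> A \<^bold>\<and> \<^bold>\<not> B \<in> \<Delta> \<or> \<^bold>\<not> A \<^bold>\<and> B \<in> \<Delta>"
  proof
    assume "A \<^bold>\<or> B \<in> \<Delta>"
    then show "A \<^bold>\<and> B \<in> \<Delta> \<or> A \<^bold>\<and> \<^bold>\<not> B \<in> \<Delta> \<or> \<^bold>\<not> A \<^bold>\<and> B \<in> \<Delta>"
      using assms by (auto simp: saturated_def)
  qed (blast intro: assms saturated_closed derives.DisI1 derives.DisI2 derives.DisI3 derives.Assm)
  then show ?thesis
    by (simp add: saturated_Con[OF assms])
qed

lemma saturated_excluded_middle:
  "saturated \<Delta> \<Longrightarrow> A \<^bold>\<or> \<^bold>\<not> A \<in> \<Delta> \<longleftrightarrow> A \<in> \<Delta> \<or> \<^bold>\<not> A \<in> \<Delta>"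
  by (auto simp: saturated_Dis saturated_Neg_Neg)

lemma saturated_Neg_Dis:
  "saturated \<Delta> \<Longrightarrow> \<^bold>\<not> (A \<^bold>\<or> B) \<in> \<Delta> \<longleftrightarrow> \<^bold>\<not> A \<in> \<Delta> \<and> \<^bold>\<not> B \<in> \<Delta>"
  unfolding saturated_Con[symmetric]
  by (blast intro: saturated_closed derives.NegDisI derives.NegDisE derives.Assm)

lemma saturated_Neg_Con:
  assumes "saturated \<Delta>"
  shows "\<^bold>\<not> (A \<^bold>\<and> B) \<in> \<Delta> \<longleftrightarrow>
    \<^bold>\<not> A \<in> \<Delta> \<and> \<^bold>\<not> B \<in> \<Delta> \<or> \<^bold>\<not> A \<in> \<Delta> \<and> B \<in> \<Delta> \<or> A \<in> \<Delta> \<and> \<^bold>\<not> B \<in> \<Delta>"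
proof -
  have "\<^bold>\<not> (A \<^bold>\<and> B) \<in> \<Delta> \<longleftrightarrow> \<^bold>\<not> A \<^bold>\<or> \<^bold>\<not> B \<in> \<Delta>"
    by (blast intro: assms saturated_closed derives.NegConI derives.NegConE derives.Assm)
  then show ?thesis
    by (simp add: saturated_Dis[OF assms] saturated_Neg_Neg[OF assms])
qed

lemma saturated_Box_excluded_middle:
  assumes "saturated \<Delta>"
  shows "\<^bold>\<box> (A \<^bold>\<or> \<^bold>\<not> A) \<in> \<Delta> \<longleftrightarrow> \<^bold>\<box> A \<in> \<Delta> \<or> \<^bold>\<not> \<^bold>\<box> A \<in> \<Delta>"
  unfolding saturated_excluded_middle[OF assms, symmetric]
  by (blast intro: assms saturated_closed derives.NegBoxI derives.NegBoxE derives.Assm)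

section \<open>The canonical model\<close>

definition canonical_model :: "('p fm set, 'p) model" where
  "canonical_model = \<lparr>worlds = {\<Delta>. saturated \<Delta>},
    rel = {(\<Delta>, \<Theta>). saturated \<Delta> \<and> saturated \<Theta> \<and> {B. \<^bold>\<box> B \<in> \<Delta>} \<subseteq> \<Theta>},
    valuation = (\<lambda>\<Delta> p. if Atom p \<in> \<Delta> then T else if \<^bold>\<not> Atom p \<in> \<Delta> then F else U)\<rparr>"

text \<open>
  If \<open>A\<close> followed from the formulae whose box is in \<open>\<Delta>\<close>, the rule introducing a box would put
  \<open>\<^bold>\<box> A\<close> into \<open>\<Delta>\<close>; otherwise these formulae have a saturated extension without \<open>A\<close>.
\<close>
lemma saturated_Box_iff:
  assumes "saturated \<Delta>"
  shows "\<^bold>\<box> A \<in> \<Delta> \<longleftrightarrow> (\<forall>\<Theta>. (\<Delta>, \<Theta>) \<in> rel canonical_model \<longrightarrow> A \<in> \<Theta>)"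
proof
  assume "\<^bold>\<box> A \<in> \<Delta>"
  then show "\<forall>\<Theta>. (\<Delta>, \<Theta>) \<in> rel canonical_model \<longrightarrow> A \<in> \<Theta>"
    by (auto simp: canonical_model_def)
next
  assume all: "\<forall>\<Theta>. (\<Delta>, \<Theta>) \<in> rel canonical_model \<longrightarrow> A \<in> \<Theta>"
  have "{B. \<^bold>\<box> B \<in> \<Delta>} \<turnstile> A"
  proof (rule ccontr)
    assume "\<not> {B. \<^bold>\<box> B \<in> \<Delta>} \<turnstile> A"
    then obtain \<Theta> where "saturated \<Theta>" "{B. \<^bold>\<box> B \<in> \<Delta>} \<subseteq> \<Theta>" "A \<notin> \<Theta>"
      using lindenbaum by blast
    then show False
      using all assms by (auto simp: canonical_model_def)
  qed
  from derives.BoxI[OF this] have "\<Delta> \<turnstile> \<^bold>\<box> A"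
    by (rule derives.Weaken) auto
  then show "\<^bold>\<box> A \<in> \<Delta>"
    using assms by (simp add: saturated_closed)
qed

text \<open>
  By the rules for the necessity of excluded middle, \<open>\<^bold>\<box> A\<close> or its negation is in \<open>\<Delta>\<close>
  exactly when every successor decides \<open>A\<close>; by the preceding lemma, a successor without \<open>A\<close>
  is what rules out \<open>\<^bold>\<box> A\<close> itself.
\<close>
lemma saturated_Neg_Box_iff:
  assumes "saturated \<Delta>"
  shows "\<^bold>\<not> \<^bold>\<box> A \<in> \<Delta> \<longleftrightarrow>
    (\<forall>\<Theta>. (\<Delta>, \<Theta>) \<in> rel canonical_model \<longrightarrow> A \<in> \<Theta> \<or> \<^bold>\<not> A \<in> \<Theta>) \<and>
    (\<exists>\<Theta>. (\<Delta>, \<Theta>) \<in> rel canonical_model \<and> A \<notin> \<Theta>)"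
proof -
  have "\<^bold>\<not> \<^bold>\<box> A \<in> \<Delta> \<longleftrightarrow> \<^bold>\<box> (A \<^bold>\<or> \<^bold>\<not> A) \<in> \<Delta> \<and> \<^bold>\<box> A \<notin> \<Delta>"
    using saturated_Box_excluded_middle[OF assms] saturated_consistent[OF assms] by blast
  moreover have "\<^bold>\<box> (A \<^bold>\<or> \<^bold>\<not> A) \<in> \<Delta> \<longleftrightarrow>
      (\<forall>\<Theta>. (\<Delta>, \<Theta>) \<in> rel canonical_model \<longrightarrow> A \<in> \<Theta> \<or> \<^bold>\<not> A \<in> \<Theta>)"
    unfolding saturated_Box_iff[OF assms]
    using saturated_excluded_middle by (auto simp: canonical_model_def)
  ultimately show ?thesis
    using saturated_Box_iff[OF assms] by blast
qed

lemma truth_lemma: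
  assumes "saturated \<Delta>"
  shows "(Val canonical_model \<Delta> A = T \<longleftrightarrow> A \<in> \<Delta>) \<and> (Val canonical_model \<Delta> A = F \<longleftrightarrow> \<^bold>\<not> A \<in> \<Delta>)"
  using assms
proof (induction A arbitrary: \<Delta>)
  case (Atom p)
  then show ?case
    using saturated_consistent by (auto simp: canonical_model_def)
next
  case (Neg A)
  then show ?case
    by (simp add: saturated_Neg_Neg)
next
  case (Con A B)
  then show ?case
    by (auto simp: saturated_Con saturated_Neg_Con)
next
  case (Dis A B)
  then show ?case
    by (auto simp: saturated_Dis saturated_Neg_Dis)
next
  case (Box A)
  have defined: "x \<noteq> U \<longleftrightarrow> x = T \<or> x = F" for x
    by (cases x) auto
  have IH: "(Val canonical_model \<Theta> A = T \<longleftrightarrow> A \<in> \<Theta>) \<and> (Val canonical_model \<Theta> A = F \<longleftrightarrow> \<^bold>\<not> A \<in> \<Theta>)"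
    if "(\<Delta>, \<Theta>) \<in> rel canonical_model" for \<Theta>
    using Box.IH that by (simp add: canonical_model_def)
  show ?case
    unfolding Val_Box_eq_T_iff Val_Box_eq_F_iff defined
      saturated_Box_iff[OF Box.prems] saturated_Neg_Box_iff[OF Box.prems]
    using IH by blast
qed

lemma completeness:
  fixes \<Gamma> :: "'p fm set"
  assumes consequence: "\<Gamma> \<Turnstile>\<^bsub>TYPE('p fm set)\<^esub> A"
  shows "\<Gamma> \<turnstile> A"
proof (rule ccontr)
  assume "\<not> \<Gamma> \<turnstile> A"
  then obtain \<Delta> where \<Delta>: "saturated \<Delta>" "\<Gamma> \<subseteq> \<Delta>" "A \<notin> \<Delta>"
    using lindenbaum by blast
  have world: "\<Delta> \<in> worlds canonical_model"
    using \<Delta>(1) by (simp add: canonical_model_def)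
  then have "kripke_model (canonical_model :: ('p fm set, 'p) model)"
    by (auto simp: kripke_model_def canonical_model_def)
  moreover have "\<forall>B\<in>\<Gamma>. canonical_model, \<Delta> \<Turnstile> B"
    using \<Delta>(2) truth_lemma[OF \<Delta>(1)] by (auto simp: satisfies_def)
  ultimately have "canonical_model, \<Delta> \<Turnstile> A"
    using consequence world unfolding consequence_def by blast
  then show False
    using truth_lemma[OF \<Delta>(1)] \<Delta>(3) by (simp add: satisfies_def)
qed

theorem theorem3:
  fixes \<Gamma> :: "'p::countable fm set" and A :: "'p fm"
  shows "(\<Gamma> \<turnstile> A \<longleftrightarrow> \<Gamma> \<Turnstile>\<^bsub>TYPE('p fm set)\<^esub> A) \<and> (\<Gamma> \<turnstile> A \<longrightarrow> \<Gamma> \<Turnstile>\<^bsub>TYPE('w)\<^esub> A)"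
  by (intro conjI iffI impI) (erule completeness derives_imp_consequence)+

end
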